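(* Let $n\ge 2$, $s\in[f_n]$ and $\iota,\kappa\in I_n$. The following are equivalent: (1) $(\iota,\kappa)\in P(w_n,s)$; (2) $a_n(\iota)\approx^*_{n,s}a_n(\kappa)$.
   Context: The Fibonacci numbers are $f_0=1$, $f_1=1$, $f_i=f_{i-1}+f_{i-2}$. Let $[m]=\{1,\dots,m\}$, $I_n=R_n=\mathbb{Z}/f_n\mathbb{Z}$, and let $\overline{i}$ be the class of $i$. Let $o_n=-1$ if $n$ is even and $o_n=0$ if $n$ is odd. Put $\check{R}_n=\{\overline{x+o_n}\in R_n: x\in[f_{n-2}]\}$ and $\widehat{R}_n=\{\overline{x+f_{n-2}+o_n}\in R_n: x\in[f_{n-1}]\}$ (these partition $R_n$). Define $a_n,a_n^*:I_n\to R_n$ by $a_n(\iota)=\overline{f_{n-1}}\,\iota$ and $a_n^*(\iota)=\overline{f_{n-2}}\,\iota$. Define $w_n:I_n\to\{0,1\}$ by $w_n(\iota)=0$ if $a_n(\iota)\in\check{R}_n$ and $w_n(\iota)=1$ if $a_n(\iota)\in\widehat{R}_n$. For $s>0$, $P(w_n,s)=\{(\iota,\kappa)\in I_n\times I_n: w_n(\iota+\overline{t-1})=w_n(\kappa+\overline{t-1})\text{ for all }t\in[s]\}$. Let $X=\{a_n^*(\overline{t})+\overline{o_n}: 0\le t\le s\}\subset R_n$. For integers $a<b$ with $b-a<f_n$ write $a\sim b$ if $\overline{c}\notin X$ for all integers $c$ with $a\le c<b$. Then $\approx^*_{n,s}$ is the equivalence relation on $R_n$ generated by $\overline{a}\approx^*_{n,s}\overline{b}$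 whenever $a\sim b$. *)

theory Defs
  imports "HOL-Number_Theory.Number_Theory"
begin

(* The library function fib starts with fib 0 = 0, fib 1 = 1; here f_0 = f_1 = 1. *)
definition fb :: "nat \<Rightarrow> nat" where
  "fb i = fib (Suc i)"

lemma fb_rec: "fb 0 = 1" "fb 1 = 1" "i \<ge> 2 \<Longrightarrow> fb i = fb (i - 1) + fb (i - 2)"
  by (auto simp: fb_def numeral_2_eq_2 dest!: le_Suc_ex)

definition off :: "nat \<Rightarrow> int" where
  "off n = (if even n then -1 else 0)"

(* R_n = I_n = Z / f_n Z, on the representatives 0, ..., f_n - 1. *)
definition RR :: "nat \<Rightarrow> int ring" where
  "RR n = residue_ring (int (fb n))"

definition cls :: "nat \<Rightarrow> int \<Rightarrow> int" where
  "cls n i = i mod int (fb n)"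

(* For n < 2 the subtractions n - 1 and n - 2 below truncate; only n \<ge> 2 is meant. *)
definition R_check :: "nat \<Rightarrow> int set" where
  "R_check n = {cls n (x + off n) | x. x \<in> {1..int (fb (n - 2))}}"

definition R_hat :: "nat \<Rightarrow> int set" where
  "R_hat n = {cls n (x + int (fb (n - 2)) + off n) | x. x \<in> {1..int (fb (n - 1))}}"

definition a_map :: "nat \<Rightarrow> int \<Rightarrow> int" where
  "a_map n \<iota> = cls n (int (fb (n - 1))) \<otimes>\<^bsub>RR n\<^esub> \<iota>"

definition a_star :: "nat \<Rightarrow> int \<Rightarrow> int" where
  "a_star n \<iota> = cls n (int (fb (n - 2))) \<otimes>\<^bsub>RR n\<^esub> \<iota>"

(* On the carrier of RR n the last branch is void, by R_check_hat_partition below. *)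
definition w_word :: "nat \<Rightarrow> int \<Rightarrow> nat" where
  "w_word n \<iota> = (if a_map n \<iota> \<in> R_check n then 0
                 else if a_map n \<iota> \<in> R_hat n then 1 else undefined)"

definition P_rel :: "nat \<Rightarrow> (int \<Rightarrow> nat) \<Rightarrow> nat \<Rightarrow> (int \<times> int) set" where
  "P_rel n w s = {(\<iota>, \<kappa>) \<in> carrier (RR n) \<times> carrier (RR n).
     \<forall>t\<in>{1..s}. w (\<iota> \<oplus>\<^bsub>RR n\<^esub> cls n (int t - 1)) = w (\<kappa> \<oplus>\<^bsub>RR n\<^esub> cls n (int t - 1))}"

definition X_set :: "nat \<Rightarrow> nat \<Rightarrow> int set" where
  "X_set n s = {a_star n (cls n (int t)) \<oplus>\<^bsub>RR n\<^esub> cls n (off n) | t. t \<le> s}"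

definition sim :: "nat \<Rightarrow> nat \<Rightarrow> int \<Rightarrow> int \<Rightarrow> bool" where
  "sim n s a b \<longleftrightarrow> a < b \<and> b - a < int (fb n) \<and> (\<forall>c. a \<le> c \<and> c < b \<longrightarrow> cls n c \<notin> X_set n s)"

(* equivclp closes over all of int; the restriction makes this a relation on R_n.
   Nothing is lost, since the generating pairs already lie in R_n. *)
definition approx_star :: "nat \<Rightarrow> nat \<Rightarrow> (int \<times> int) set" where
  "approx_star n s = {(x, y) \<in> carrier (RR n) \<times> carrier (RR n).
     equivclp (\<lambda>u v. \<exists>a b. sim n s a b \<and> u = cls n a \<and> v = cls n b) x y}"

lemma fb_pos: "fb n > 0"
  by (simp add: fb_def fib_neq_0_nat)

lemma carrier_RR: "carrier (RR n) = {0..<int (fb n)}"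
  by (auto simp: RR_def residue_ring_def)

lemma cls_in_carrier: "cls n i \<in> carrier (RR n)"
  using fb_pos[of n] by (simp add: carrier_RR cls_def)

lemma approx_star_equiv: "equiv (carrier (RR n)) (approx_star n s)"
  by (rule equivI)
     (auto simp: approx_star_def refl_on_def intro!: symI transI
           intro: equivclp_refl equivclp_sym equivclp_trans)

lemma approx_star_least:
  assumes E: "equiv (carrier (RR n)) E"
    and gen: "\<And>a b. sim n s a b \<Longrightarrow> (cls n a, cls n b) \<in> E"
  shows "approx_star n s \<subseteq> E"
proof -
  have "(x, y) \<in> E"
    if "equivclp (\<lambda>u v. \<exists>a b. sim n s a b \<and> u = cls n a \<and> v = cls n b) x y"
      and "x \<in> carrier (RR n)" for x y
    using that
  proof (induction rule: equivclp_induct)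
    case base
    then show ?case using E by (meson equivE refl_onD)
  next
    case (step y z)
    then have "(y, z) \<in> E" using gen E by (metis equivE symD)
    with step E show ?case by (meson equivE transD)
  qed
  then show ?thesis by (auto simp: approx_star_def)
qed

lemma R_check_hat_partition:
  assumes "n \<ge> 2"
  shows "R_check n \<union> R_hat n = carrier (RR n)" "R_check n \<inter> R_hat n = {}"
proof -
  have f: "int (fb n) = int (fb (n - 1)) + int (fb (n - 2))"
    using fb_rec(3)[OF assms] by simp
  have uniq: "x = y"
    if "cls n (x + off n) = cls n (y + off n)" "x \<in> {1..int (fb n)}" "y \<in> {1..int (fb n)}" for x y
  proof -
    have "int (fb n) dvd x - y"
      using that(1) by (simp add: cls_def mod_eq_dvd_iff)
    moreover have "\<bar>x - y\<bar> < int (fb n)" using that by auto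
    ultimately show "x = y" using zdvd_not_zless[of "\<bar>x - y\<bar>" "int (fb n)"] by auto
  qed
  have hat: "R_hat n = {cls n (x + off n) | x. x \<in> {int (fb (n - 2)) + 1..int (fb n)}}"
  proof (intro equalityI subsetI)
    fix z assume "z \<in> R_hat n"
    then obtain x where "z = cls n (x + int (fb (n - 2)) + off n)" "x \<in> {1..int (fb (n - 1))}"
      by (auto simp: R_hat_def)
    then show "z \<in> {cls n (x + off n) | x. x \<in> {int (fb (n - 2)) + 1..int (fb n)}}"
      using f by (intro CollectI exI[of _ "x + int (fb (n - 2))"]) auto
  next
    fix z assume "z \<in> {cls n (x + off n) | x. x \<in> {int (fb (n - 2)) + 1..int (fb n)}}"
    then obtain x where "z = cls n (x + off n)" "x \<in> {int (fb (n - 2)) + 1..int (fb n)}"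
      by auto
    then show "z \<in> R_hat n"
      using f unfolding R_hat_def by (intro CollectI exI[of _ "x - int (fb (n - 2))"]) auto
  qed
  show "R_check n \<inter> R_hat n = {}"
    unfolding hat R_check_def using uniq f by fastforce
  show "R_check n \<union> R_hat n = carrier (RR n)"
  proof (intro equalityI subsetI)
    fix z assume "z \<in> R_check n \<union> R_hat n"
    then show "z \<in> carrier (RR n)" by (auto simp: R_check_def R_hat_def cls_in_carrier)
  next
    fix z assume z: "z \<in> carrier (RR n)"
    define x where "x = (z - off n - 1) mod int (fb n) + 1"
    have "x \<in> {1..int (fb n)}"
      using fb_pos[of n] by (simp add: x_def add1_zle_eq)
    moreover have "z = cls n (x + off n)"
    proof -
      have "cls n (x + off n) = ((z - off n - 1) mod int (fb n) + (1 + off n)) mod int (fb n)"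
        by (simp add: cls_def x_def add_ac)
      also have "\<dots> = z mod int (fb n)" by (simp only: mod_add_left_eq) simp
      finally show ?thesis using z by (simp add: carrier_RR)
    qed
    ultimately show "z \<in> R_check n \<union> R_hat n"
      unfolding hat R_check_def by (cases "x \<le> int (fb (n - 2))") auto
  qed
qed

end

theory Submission
  imports Defs
begin

text \<open>
  Place \<open>R\<^sub>n = \<int>/f\<^sub>n\<close> on a circle and call \<open>e\<^sub>t = f\<^sub>n\<^sub>-\<^sub>2 t + o\<^sub>n\<close> the \<open>t\<close>-th cut, so that the set \<open>X\<close>
  consists of \<open>e\<^sub>0, \<dots>, e\<^sub>s\<close>, where \<open>e\<^sub>t\<close> separates the point \<open>e\<^sub>t\<close> from \<open>e\<^sub>t + 1\<close>. The relation
  \<open>\<approx>\<^sup>*\<close> says that one of the two ways around the circle between two points meets no cut.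

  Since \<open>f\<^sub>n\<^sub>-\<^sub>1 = - f\<^sub>n\<^sub>-\<^sub>2\<close> modulo \<open>f\<^sub>n\<close>, the \<open>t\<close>-th letter of the factor at \<open>\<iota>\<close> records whether
  \<open>a\<^sub>n(\<iota>)\<close> lies on the arc from \<open>e\<^sub>t\<^sub>-\<^sub>1\<close> to \<open>e\<^sub>t\<close> (lemma \<open>w_word_eq_iff\<close>). Now the two cuts \<open>e\<^sub>t\<^sub>-\<^sub>1, e\<^sub>t\<close>
  separate two points of a circle if and only if the two points separate the two cuts
  (\<open>arc_separation_symmetric\<close>). So the factors at \<open>\<iota>\<close> and \<open>\<kappa>\<close> agree if and only if each consecutive
  pair of cuts lies on the same side of the pair \<open>a\<^sub>n(\<iota>), a\<^sub>n(\<kappa>)\<close>, that is, all the cuts lie on one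
  side, and the other side is free of cuts.
\<close>

text \<open>
  Crossing of two pairs on a circle is a symmetric notion. Here \<open>(x - e - 1) mod N < p\<close> says that \<open>x\<close>
  is one of \<open>e + 1, \<dots>, e + p\<close> modulo \<open>N\<close>, and \<open>(c - a) mod N < b - a\<close> says that \<open>c\<close> is one of
  \<open>a, \<dots>, b - 1\<close> modulo \<open>N\<close>; the ranges differ by one because the cut \<open>c\<close> lies just after the point \<open>c\<close>.
  In terms of the distance \<open>u\<close> from \<open>a\<close> forward to \<open>e\<close>, each residue wraps around at most once, which
  leaves linear inequalities.
\<close>
lemma arc_separation_symmetric:
  fixes a b e p N :: int
  assumes "0 < p" "p < N" "a \<le> b" "b - a < N"
  shows "((a - e - 1) mod N < p \<longleftrightarrow> (b - e - 1) mod N < p)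
    \<longleftrightarrow> ((e - a) mod N < b - a \<longleftrightarrow> (e + p - a) mod N < b - a)"
proof -
  have N: "N > 0" using assms by simp
  define u k where "u = (e - a) mod N" and "k = (e - a) div N"
  have e: "e = a + N * k + u" by (simp add: u_def k_def)
  have u: "0 \<le> u" "u < N" using N by (simp_all add: u_def)
  have 1: "(a - e - 1) mod N = N - 1 - u"
    using u by (intro int_mod_pos_eq[where q = "- k - 1"]) (auto simp: e algebra_simps)
  have 2: "(b - e - 1) mod N = (if u < b - a then b - a - u - 1 else b - a - u - 1 + N)"
  proof (cases "u < b - a")
    case True
    then have "(b - e - 1) mod N = b - a - u - 1"
      using u assms by (intro int_mod_pos_eq[where q = "- k"]) (auto simp: e algebra_simps)
    with True show ?thesis by simp
  next
    case False
    then have "(b - e - 1) mod N = b - a - u - 1 + N"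
      using u assms by (intro int_mod_pos_eq[where q = "- k - 1"]) (auto simp: e algebra_simps)
    with False show ?thesis by simp
  qed
  have 3: "(e + p - a) mod N = (if u + p < N then u + p else u + p - N)"
  proof (cases "u + p < N")
    case True
    then have "(e + p - a) mod N = u + p"
      using u assms by (intro int_mod_pos_eq[where q = k]) (auto simp: e algebra_simps)
    with True show ?thesis by simp
  next
    case False
    then have "(e + p - a) mod N = u + p - N"
      using u assms by (intro int_mod_pos_eq[where q = "k + 1"]) (auto simp: e algebra_simps)
    with False show ?thesis by simp
  qed
  show ?thesis
    unfolding 1 2 3 u_def[symmetric] using u assms by auto
qed

definition cut_pt :: "nat \<Rightarrow> nat \<Rightarrow> int" where
  "cut_pt n t = int (fb (n - 2)) * int t + off n"

text \<open>
  For \<open>t \<ge> 1\<close> this is the arc from \<open>cut_pt n (t - 1) + 1\<close> to \<open>cut_pt n t\<close>: a cut point is the last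
  point of the arc that it ends.
\<close>
definition on_arc :: "nat \<Rightarrow> nat \<Rightarrow> int \<Rightarrow> bool" where
  "on_arc n t x \<longleftrightarrow> (x - cut_pt n (t - 1) - 1) mod int (fb n) < int (fb (n - 2))"

lemma cls_eq_iff: "cls n x = cls n y \<longleftrightarrow> int (fb n) dvd x - y"
  by (simp add: cls_def mod_eq_dvd_iff)

lemma cls_carrier_eq: "x \<in> carrier (RR n) \<Longrightarrow> cls n x = x"
  by (simp add: carrier_RR cls_def)

lemma on_arc_cls: "on_arc n t (cls n x) \<longleftrightarrow> on_arc n t x"
  unfolding on_arc_def cls_def by (simp add: mod_diff_left_eq diff_diff_eq)

lemma int_fb_split:
  assumes "n \<ge> 2"
  shows "int (fb n) = int (fb (n - 1)) + int (fb (n - 2))"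
  using fb_rec(3)[OF assms] by simp

lemma R_check_iff:
  assumes "n \<ge> 2"
  shows "cls n x \<in> R_check n \<longleftrightarrow> (x - off n - 1) mod int (fb n) < int (fb (n - 2))"
    (is "_ \<longleftrightarrow> ?u < _")
proof
  assume "cls n x \<in> R_check n"
  then obtain y where y: "cls n x = cls n (y + off n)" "1 \<le> y" "y \<le> int (fb (n - 2))"
    by (auto simp: R_check_def)
  then have "?u = (y - 1) mod int (fb n)"
    by (simp add: cls_eq_iff mod_eq_dvd_iff algebra_simps)
  also have "\<dots> = y - 1"
    using y int_fb_split[OF assms] by (intro mod_pos_pos_trivial) auto
  finally show "?u < int (fb (n - 2))" using y by simp
next
  assume u: "?u < int (fb (n - 2))"
  have "cls n x = cls n (?u + 1 + off n)"
  proof -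
    have "cls n (?u + 1 + off n) = (?u + (1 + off n)) mod int (fb n)"
      by (simp add: cls_def add_ac)
    also have "\<dots> = cls n x"
      by (simp only: mod_add_left_eq) (simp add: cls_def)
    finally show ?thesis by simp
  qed
  moreover have "?u \<ge> 0" using fb_pos[of n] by simp
  ultimately show "cls n x \<in> R_check n"
    unfolding R_check_def using u by (intro CollectI exI[of _ "?u + 1"]) auto
qed

lemma a_map_shift:
  assumes "n \<ge> 2"
  shows "a_map n (\<iota> \<oplus>\<^bsub>RR n\<^esub> cls n z) = cls n (a_map n \<iota> - int (fb (n - 2)) * z)"
proof -
  let ?N = "int (fb n)" and ?p = "int (fb (n - 2))" and ?q = "int (fb (n - 1))"
  have "a_map n (\<iota> \<oplus>\<^bsub>RR n\<^esub> cls n z) = (?q * (\<iota> + z)) mod ?N"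
    by (simp add: a_map_def RR_def residue_ring_def cls_def mod_simps)
  also have "\<dots> = (?q * \<iota> - ?p * z) mod ?N"
  proof -
    have "?q * (\<iota> + z) - (?q * \<iota> - ?p * z) = ?N * z"
      unfolding int_fb_split[OF assms] by (simp add: algebra_simps)
    then show ?thesis by (simp add: mod_eq_dvd_iff)
  qed
  also have "\<dots> = cls n (a_map n \<iota> - ?p * z)"
    by (simp add: a_map_def RR_def residue_ring_def cls_def mod_simps)
  finally show ?thesis .
qed

text \<open>
  Shifting \<open>\<iota>\<close> by one moves \<open>a\<^sub>n(\<iota>)\<close> back by \<open>f\<^sub>n\<^sub>-\<^sub>2\<close>, so instead of moving the point past the fixed
  arc of the letter \<open>0\<close> one may fix the point and move the arc forward, from cut to cut.
\<close>
lemma w_word_eq_iff: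
  assumes "n \<ge> 2" "t \<ge> 1"
  shows "w_word n (\<iota> \<oplus>\<^bsub>RR n\<^esub> cls n (int t - 1)) = w_word n (\<kappa> \<oplus>\<^bsub>RR n\<^esub> cls n (int t - 1))
    \<longleftrightarrow> (on_arc n t (a_map n \<iota>) \<longleftrightarrow> on_arc n t (a_map n \<kappa>))"
proof -
  have w: "w_word n (\<mu> \<oplus>\<^bsub>RR n\<^esub> cls n (int t - 1)) = (if on_arc n t (a_map n \<mu>) then 0 else 1)"
    for \<mu>
  proof -
    let ?x = "a_map n \<mu> - int (fb (n - 2)) * (int t - 1)"
    have "cls n ?x \<in> R_check n \<longleftrightarrow> on_arc n t (a_map n \<mu>)"
      using assms by (simp add: R_check_iff on_arc_def cut_pt_def of_nat_diff algebra_simps)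
    then show ?thesis
      using R_check_hat_partition(1)[OF assms(1)] cls_in_carrier[of n ?x]
      by (auto simp: w_word_def a_map_shift[OF assms(1)])
  qed
  show ?thesis unfolding w by simp
qed

lemma cls_in_X_set_iff: "cls n c \<in> X_set n s \<longleftrightarrow> (\<exists>t\<le>s. cls n c = cls n (cut_pt n t))"
  by (auto simp: X_set_def a_star_def RR_def residue_ring_def cls_def cut_pt_def mod_simps)

lemma sim_iff_no_cut:
  "sim n s a b \<longleftrightarrow> a < b \<and> b - a < int (fb n)
     \<and> (\<forall>t\<le>s. \<not> (cut_pt n t - a) mod int (fb n) < b - a)"
proof -
  have "(\<exists>c. a \<le> c \<and> c < b \<and> cls n c = cls n d) \<longleftrightarrow> (d - a) mod int (fb n) < b - a"
    if "b - a < int (fb n)" for d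
  proof
    assume "\<exists>c. a \<le> c \<and> c < b \<and> cls n c = cls n d"
    then obtain c where c: "a \<le> c" "c < b" "cls n c = cls n d" by auto
    then have "(d - a) mod int (fb n) = (c - a) mod int (fb n)"
      by (metis cls_def mod_diff_left_eq)
    also have "\<dots> = c - a" using c that by (intro mod_pos_pos_trivial) auto
    finally show "(d - a) mod int (fb n) < b - a" using c by simp
  next
    assume "(d - a) mod int (fb n) < b - a"
    moreover have "cls n (a + (d - a) mod int (fb n)) = cls n d"
      by (simp add: cls_def mod_simps)
    moreover have "(d - a) mod int (fb n) \<ge> 0" using fb_pos[of n] by simp
    ultimately show "\<exists>c. a \<le> c \<and> c < b \<and> cls n c = cls n d"
      by (intro exI[of _ "a + (d - a) mod int (fb n)"]) auto
  qed
  then show ?thesis unfolding sim_def cls_in_X_set_iff by metis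
qed

lemma on_arc_agree_iff:
  assumes "n \<ge> 2" "t \<ge> 1" "a \<le> b" "b - a < int (fb n)"
  shows "(on_arc n t a \<longleftrightarrow> on_arc n t b)
    \<longleftrightarrow> ((cut_pt n (t - 1) - a) mod int (fb n) < b - a \<longleftrightarrow> (cut_pt n t - a) mod int (fb n) < b - a)"
proof -
  have "cut_pt n t = cut_pt n (t - 1) + int (fb (n - 2))"
    using assms by (simp add: cut_pt_def of_nat_diff algebra_simps)
  moreover have "0 < int (fb (n - 2))" "int (fb (n - 2)) < int (fb n)"
    using fb_pos int_fb_split[OF assms(1)] by simp_all
  ultimately show ?thesis
    using arc_separation_symmetric[of "int (fb (n - 2))" "int (fb n)" a b "cut_pt n (t - 1)"] assms
    by (simp add: on_arc_def)
qed

lemma approx_star_imp_on_arc_agree: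
  assumes "n \<ge> 2" "(x, y) \<in> approx_star n s" "t \<in> {1..s}"
  shows "on_arc n t x \<longleftrightarrow> on_arc n t y"
proof -
  define E where "E = {(x, y) \<in> carrier (RR n) \<times> carrier (RR n).
    \<forall>t\<in>{1..s}. on_arc n t x \<longleftrightarrow> on_arc n t y}"
  have "equiv (carrier (RR n)) E"
    by (rule equivI) (auto simp: E_def refl_on_def intro!: symI transI)
  moreover have "(cls n a, cls n b) \<in> E" if "sim n s a b" for a b
    using that assms(1)
    by (auto simp: E_def cls_in_carrier on_arc_cls sim_iff_no_cut on_arc_agree_iff)
  ultimately have "approx_star n s \<subseteq> E" by (rule approx_star_least)
  with assms show ?thesis by (auto simp: E_def)
qed

lemma sim_imp_approx_star: "sim n s a b \<Longrightarrow> (cls n a, cls n b) \<in> approx_star n s"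
  by (auto simp: approx_star_def cls_in_carrier intro!: r_into_equivclp)

text \<open>
  If consecutive cuts always lie on the same side of the pair \<open>x, y\<close>, then all the cuts do. If none
  lies on the arc from \<open>x\<close> to \<open>y\<close>, this arc connects the points; if all do, the complementary arc
  from \<open>y\<close> around to \<open>x + f\<^sub>n\<close> connects them.
\<close>
lemma on_arc_agree_imp_approx_star_less:
  assumes "n \<ge> 2" "x \<in> carrier (RR n)" "y \<in> carrier (RR n)" "x < y"
    and agree: "\<And>t. t \<in> {1..s} \<Longrightarrow> on_arc n t x \<longleftrightarrow> on_arc n t y"
  shows "(x, y) \<in> approx_star n s"
proof -
  let ?N = "int (fb n)"
  define inside where "inside t \<longleftrightarrow> (cut_pt n t - x) mod ?N < y - x" for t
  have xy: "0 \<le> x" "y < ?N" using assms by (auto simp: carrier_RR)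
  have const: "inside t \<longleftrightarrow> inside 0" if "t \<le> s" for t
    using that
  proof (induction t)
    case (Suc t)
    then have "on_arc n (Suc t) x \<longleftrightarrow> on_arc n (Suc t) y" by (intro agree) auto
    then have "inside t \<longleftrightarrow> inside (Suc t)"
      using on_arc_agree_iff[of n "Suc t" x y] assms xy by (simp add: inside_def)
    with Suc show ?case by simp
  qed simp
  show ?thesis
  proof (cases "inside 0")
    case False
    then have "sim n s x y"
      using const assms xy by (auto simp: sim_iff_no_cut inside_def)
    from sim_imp_approx_star[OF this] show ?thesis
      using assms by (simp add: cls_carrier_eq)
  next
    case True
    have "cls n c \<notin> X_set n s" if c: "y \<le> c" "c < x + ?N" for c
    proof
      assume "cls n c \<in> X_set n s"
      then obtain t where t: "t \<le> s" "cls n c = cls n (cut_pt n t)"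
        by (auto simp: cls_in_X_set_iff)
      have "(cut_pt n t - x) mod ?N = (c - x) mod ?N"
        using t(2) by (metis cls_def mod_diff_left_eq)
      also have "\<dots> = c - x"
        using c \<open>x < y\<close> by (intro mod_pos_pos_trivial) auto
      finally have "\<not> inside t" using c by (simp add: inside_def)
      with const[OF t(1)] True show False by simp
    qed
    then have "sim n s y (x + ?N)"
      using xy \<open>x < y\<close> by (auto simp: sim_def)
    moreover have "cls n (x + ?N) = x"
      using cls_carrier_eq[OF assms(2)] by (simp add: cls_def)
    ultimately have "(y, x) \<in> approx_star n s"
      using sim_imp_approx_star[of n s y "x + ?N"] assms(3) by (simp add: cls_carrier_eq)
    then show ?thesis
      using approx_star_equiv[of n s] by (meson equivE symD)
  qed
qed

lemma approx_star_iff_on_arc_agree: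
  assumes "n \<ge> 2" "x \<in> carrier (RR n)" "y \<in> carrier (RR n)"
  shows "(x, y) \<in> approx_star n s \<longleftrightarrow> (\<forall>t\<in>{1..s}. on_arc n t x \<longleftrightarrow> on_arc n t y)"
proof
  assume "(x, y) \<in> approx_star n s"
  then show "\<forall>t\<in>{1..s}. on_arc n t x \<longleftrightarrow> on_arc n t y"
    using approx_star_imp_on_arc_agree[OF assms(1)] by blast
next
  assume agree: "\<forall>t\<in>{1..s}. on_arc n t x \<longleftrightarrow> on_arc n t y"
  consider "x < y" | "x = y" | "y < x" by linarith
  then show "(x, y) \<in> approx_star n s"
  proof cases
    case 1
    with agree assms show ?thesis by (intro on_arc_agree_imp_approx_star_less) auto
  next
    case 2
    with assms approx_star_equiv[of n s] show ?thesis by (meson equivE refl_onD)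
  next
    case 3
    with agree assms have "(y, x) \<in> approx_star n s"
      by (intro on_arc_agree_imp_approx_star_less) auto
    with approx_star_equiv[of n s] show ?thesis by (meson equivE symD)
  qed
qed

theorem corollary3p10:
  fixes n s :: nat and \<iota> \<kappa> :: int
  assumes "n \<ge> 2"
    and "s \<in> {1..fb n}"
    and "\<iota> \<in> carrier (RR n)"
    and "\<kappa> \<in> carrier (RR n)"
  shows "(\<iota>, \<kappa>) \<in> P_rel n (w_word n) s \<longleftrightarrow> (a_map n \<iota>, a_map n \<kappa>) \<in> approx_star n s"
proof -
  have carrier: "a_map n \<mu> \<in> carrier (RR n)" for \<mu>
    using fb_pos[of n] by (simp add: a_map_def RR_def residue_ring_def)
  have "(\<iota>, \<kappa>) \<in> P_rel n (w_word n) s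
    \<longleftrightarrow> (\<forall>t\<in>{1..s}. on_arc n t (a_map n \<iota>) \<longleftrightarrow> on_arc n t (a_map n \<kappa>))"
    using assms by (simp add: P_rel_def w_word_eq_iff)
  also have "\<dots> \<longleftrightarrow> (a_map n \<iota>, a_map n \<kappa>) \<in> approx_star n s"
    using approx_star_iff_on_arc_agree[OF assms(1) carrier carrier] by simp
  finally show ?thesis .
qed

end
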